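(* Let $f:\mathbb{R}^N\times\mathbb{R}^m\to\mathbb{R}^N$ and $g:\mathbb{R}^N\times\mathbb{R}^m\to\mathbb{R}^m$ be continuously differentiable, and assume that the system $\frac{d}{dt}v=f(v,w)$, $\frac{d}{dt}w=g(v,w)$ conserves the energy $E=\frac12(\|v\|^2+\|w\|^2)$, i.e. $E$ is constant in time along every solution, for arbitrary initial values $(v(0),w(0))\in\mathbb{R}^N\times\mathbb{R}^m$. Define $$F(v,t)=f(v,0)+t\,D_wf(v,0)\cdot g(v,0),\qquad v\in\mathbb{R}^N,\ t\ge 0.$$ Let $s\ge 1$ and let $a_{ij},b_i,c_i$ ($i,j=1,\dots,s$) be real numbers with $b_i\ge 0$, $c_i\ge 0$ such that $$b_ia_{ij}+b_ja_{ji}-b_ib_j=0\quad\text{for all } i,j=1,\dots,s,\qquad \sum_{i=1}^s b_i=1,\qquad \sum_{i=1}^s b_ic_i=\frac12 .$$ Let $h>0$, let $n\ge 0$ be an integer, let $t_n=nh$ and $v^n\in\mathbb{R}^N$, and suppose that $k_1,\dots,k_s\in\mathbb{R}^N$ and $v^{n+1}\in\mathbb{R}^N$ satisfy the Runge-Kutta equations $$k_i=F\Big(v^n+h\sum_{j=1}^s a_{ij}k_j,\ t_n+hc_i\Big)\quad (i=1,\dots,s),\qquad v^{n+1}=v^n+h\sum_{i=1}^s b_ik_i .$$ Set $V_i=v^n+h\sum_{j=1}^s a_{ij}k_j$ for $i=1,\dots,s$. Then there is a point $\tilde V$ in the convex hull of $V_1,\dots,V_s$ such that $$\frac12\|v^{n+1}\|^2-\frac12\|v^n\|^2=-h\Big(t_n+\frac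 h2\Big)\|g(\tilde V,0)\|^2 .$$
   Context: $\|\cdot\|$ denotes the Euclidean norm on $\mathbb{R}^N$ and on $\mathbb{R}^m$, coming from the inner products $(v,v')=\sum_i v_iv_i'$ and $(w,w')=\sum_i w_iw_i'$. $D_wf(v,0)$ is the $N\times m$ matrix of partial derivatives of $f(v,w)$ with respect to the components of $w$, evaluated at $w=0$. The equation $\frac{d}{dt}v(t)=F(v(t),t)$ is called the $t$-model of the system; the Runge-Kutta equations define one step (of size $h$, from time $t_n$ to $t_{n+1}$) of an (in general implicit) $s$-stage Runge-Kutta method with coefficients $a_{ij},b_i,c_i$ applied to the $t$-model. *)

theory Defs
  imports "HOL-Analysis.Analysis"
begin

definition continuously_differentiable ::
  "('a::real_normed_vector \<Rightarrow> 'b::real_normed_vector) \<Rightarrow> bool" where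
  "continuously_differentiable f \<longleftrightarrow>
     (\<exists>f' :: 'a \<Rightarrow> 'a \<Rightarrow>\<^sub>L 'b.
        (\<forall>x. (f has_derivative blinfun_apply (f' x)) (at x)) \<and> continuous_on UNIV f')"

text \<open>Solutions are only required to exist on the interval \<open>J\<close>, since solutions of the system
  are a priori only local in time. At endpoints of \<open>J\<close> the derivative is one-sided.\<close>

definition solves_system ::
  "((real^'N) \<times> (real^'m) \<Rightarrow> real^'N) \<Rightarrow> ((real^'N) \<times> (real^'m) \<Rightarrow> real^'m)
    \<Rightarrow> real set \<Rightarrow> (real \<Rightarrow> real^'N) \<Rightarrow> (real \<Rightarrow> real^'m) \<Rightarrow> bool" where
  "solves_system f g J v w \<longleftrightarrow>
     (\<forall>t\<in>J. (v has_vector_derivative f (v t, w t)) (at t within J) \<and>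
            (w has_vector_derivative g (v t, w t)) (at t within J))"

definition energy :: "real^'N \<Rightarrow> real^'m \<Rightarrow> real" where
  "energy v w = 1/2 * ((norm v)\<^sup>2 + (norm w)\<^sup>2)"

definition conserves_energy ::
  "((real^'N) \<times> (real^'m) \<Rightarrow> real^'N) \<Rightarrow> ((real^'N) \<times> (real^'m) \<Rightarrow> real^'m) \<Rightarrow> bool" where
  "conserves_energy f g \<longleftrightarrow>
     (\<forall>J v w. is_interval J \<and> 0 \<in> J \<and> solves_system f g J v w
        \<longrightarrow> (\<forall>t\<in>J. energy (v t) (w t) = energy (v 0) (w 0)))"

text \<open>The entry in row \<open>i\<close> and column \<open>j\<close> is the partial derivative of the \<open>i\<close>-th component of
  \<open>f\<close> with respect to the \<open>j\<close>-th component of \<open>w\<close>.\<close>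

definition D_w ::
  "((real^'N) \<times> (real^'m) \<Rightarrow> real^'N) \<Rightarrow> real^'N \<Rightarrow> real^'m \<Rightarrow> real^'m^'N" where
  "D_w f v w = (\<chi> i j. deriv (\<lambda>x. f (v, w + axis j x) $ i) 0)"

lemma D_w_eq_jacobian:
  fixes f :: "(real^'N) \<times> (real^'m) \<Rightarrow> real^'N"
  assumes "(\<lambda>w. f (v, w)) differentiable (at w)"
  shows "D_w f v w = jacobian (\<lambda>w. f (v, w)) (at w)"
proof -
  define L where "L = frechet_derivative (\<lambda>w. f (v, w)) (at w)"
  have L: "((\<lambda>w. f (v, w)) has_derivative L) (at w)"
    using assms by (simp add: L_def frechet_derivative_works)
  have "deriv (\<lambda>x. f (v, w + axis j x) $ i) 0 = L (axis j 1) $ i" for i j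
  proof -
    have eq: "axis j x = x *\<^sub>R (axis j 1 :: real^'m)" for x :: real
      by (simp add: vec_eq_iff axis_def)
    have "((\<lambda>x. w + x *\<^sub>R axis j 1) has_derivative (\<lambda>x. x *\<^sub>R axis j 1)) (at 0)"
      by (auto intro!: derivative_eq_intros)
    moreover have "((\<lambda>w. f (v, w)) has_derivative L) (at (w + 0 *\<^sub>R axis j 1))"
      using L by simp
    ultimately have "((\<lambda>x. f (v, w + x *\<^sub>R axis j 1)) has_derivative (\<lambda>x. L (x *\<^sub>R axis j 1))) (at 0)"
      by (rule has_derivative_compose)
    then have "((\<lambda>x. f (v, w + x *\<^sub>R axis j 1) $ i) has_derivative (\<lambda>x. L (x *\<^sub>R axis j 1) $ i)) (at 0)"
      by (rule bounded_linear.has_derivative[OF bounded_linear_vec_nth])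
    moreover have "(\<lambda>x. L (x *\<^sub>R axis j 1) $ i) = (*) (L (axis j 1) $ i)"
      using linear_scale[OF has_derivative_linear[OF L]] by (simp add: fun_eq_iff mult.commute)
    ultimately have "((\<lambda>x. f (v, w + axis j x) $ i) has_field_derivative L (axis j 1) $ i) (at 0)"
      by (subst eq) (simp add: has_field_derivative_def)
    then show ?thesis by (rule DERIV_imp_deriv)
  qed
  then show ?thesis
    by (simp add: D_w_def jacobian_def matrix_def L_def)
qed

definition t_model ::
  "((real^'N) \<times> (real^'m) \<Rightarrow> real^'N) \<Rightarrow> ((real^'N) \<times> (real^'m) \<Rightarrow> real^'m)
    \<Rightarrow> real^'N \<Rightarrow> real \<Rightarrow> real^'N" where
  "t_model f g v t = f (v, 0) + t *\<^sub>R (D_w f v 0 *v g (v, 0))"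

end

(* Conservation of energy forces (v, f(v,w)) + (w, g(v,w)) = 0 at every point: a solution through that
   point exists on a short interval, and one differentiates E along it at t = 0. At w = 0 this reads
   (v, f(v,0)) = 0, and differentiating it in w at w = 0 gives (v, D_w f(v,0) y) = -(g(v,0), y). Hence
   (v, F(v,t)) = -t |g(v,0)|^2. The algebraic condition on a and b makes
   |v^{n+1}|^2 - |v^n|^2 equal to 2h times the sum of b_i (V_i, k_i), so the energy change is
   -h (t_n + h/2) times a weighted average of the |g(V_i,0)|^2, and the intermediate value theorem
   on the connected convex hull of the V_i turns that average into a single value. *)

theory Submission imports Defs begin

section \<open>Local existence for ordinary differential equations\<close>

text \<open>Picard's argument: a solution is a fixed point of the integral operator
  \<open>P\<close>, which contracts the complete space of bounded continuous functions once the time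
  span is short. Because \<open>G\<close> is Lipschitz everywhere, the iterates need not be confined
  to a ball.\<close>

lemma lipschitz_ode_solution_exists:
  fixes G :: "'a::euclidean_space \<Rightarrow> 'a"
  assumes G: "L-lipschitz_on UNIV G"
  obtains \<delta> u where "\<delta> > 0" "u 0 = x"
    and "\<And>t. t \<in> {0..\<delta>} \<Longrightarrow> (u has_vector_derivative G (u t)) (at t within {0..\<delta>})"
proof -
  \<comment> \<open>This length makes the contraction factor \<open>L * \<delta>\<close> at most
    1/2; the summand 1 keeps the denominator positive when \<open>L = 0\<close>.\<close>
  define \<delta> where "\<delta> = 1 / (2 * (L + 1))"
  have L: "0 \<le> L" using G by (rule lipschitz_on_nonneg)
  have \<delta>: "\<delta> > 0" and \<delta>L: "L * \<delta> \<le> 1/2"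
    using L by (auto simp: \<delta>_def field_simps)
  have G_cont: "continuous_on UNIV G" using G by (rule lipschitz_on_continuous_on)
  \<comment> \<open>Clamping time to \<open>{0..\<delta>}\<close> makes \<open>P u\<close> bounded
    and continuous on the whole real line, as the type of bounded continuous functions demands. On
    \<open>{0..\<delta>}\<close> itself \<open>r\<close> is the identity, so the fixed point
    satisfies the genuine integral equation there.\<close>
  define r :: "real \<Rightarrow> real" where "r t = max 0 (min \<delta> t)" for t
  have r: "r t \<in> {0..\<delta>}" for t using \<delta> by (auto simp: r_def)
  have r_cont: "continuous_on S r" for S unfolding r_def by (intro continuous_intros)
  define P where "P u t = x + integral {0..r t} (\<lambda>\<tau>. G (apply_bcontfun u \<tau>))" for u :: "real \<Rightarrow>\<^sub>C 'a" and t
  have Gu: "continuous_on S (\<lambda>\<tau>. G (apply_bcontfun u \<tau>))" for S and u :: "real \<Rightarrow>\<^sub>C 'a"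
    by (rule continuous_on_compose2[OF G_cont]) auto
  have I_cont: "continuous_on {0..\<delta>} (\<lambda>t. integral {0..t} (\<lambda>\<tau>. G (apply_bcontfun u \<tau>)))" for u :: "real \<Rightarrow>\<^sub>C 'a"
    by (intro indefinite_integral_continuous_1 integrable_continuous_real Gu)
  have P_bcontfun: "P u \<in> bcontfun" for u
  proof -
    have "continuous_on UNIV (P u)"
      unfolding P_def using r
      by (intro continuous_intros continuous_on_compose2[OF I_cont r_cont]) auto
    moreover have "bounded ((\<lambda>t. x + integral {0..t} (\<lambda>\<tau>. G (apply_bcontfun u \<tau>))) ` {0..\<delta>})"
      by (intro compact_imp_bounded compact_continuous_image continuous_intros I_cont) auto
    then have "bounded (range (P u))"
      by (rule bounded_subset) (use r in \<open>auto simp: P_def\<close>)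
    ultimately show ?thesis by (simp add: bcontfun_def)
  qed
  have apply_P: "apply_bcontfun (Bcontfun (P u)) = P u" for u
    using P_bcontfun by (rule Bcontfun_inverse)
  have "dist (Bcontfun (P u)) (Bcontfun (P w)) \<le> 1/2 * dist u w" for u w
  proof (rule dist_bound)
    fix t
    have int: "(\<lambda>\<tau>. G (apply_bcontfun v \<tau>)) integrable_on {0..r t}" for v :: "real \<Rightarrow>\<^sub>C 'a"
      by (intro integrable_continuous_real Gu)
    have "dist (P u t) (P w t)
        = norm (integral {0..r t} (\<lambda>\<tau>. G (apply_bcontfun u \<tau>) - G (apply_bcontfun w \<tau>)))"
      by (simp add: P_def dist_norm integral_diff[OF int int])
    also have "\<dots> \<le> (L * dist u w) * (r t - 0)"
    proof (rule integral_bound)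
      show "norm (G (apply_bcontfun u \<tau>) - G (apply_bcontfun w \<tau>)) \<le> L * dist u w" for \<tau>
        using lipschitz_on_normD[OF G, of "apply_bcontfun u \<tau>" "apply_bcontfun w \<tau>"]
          mult_left_mono[OF dist_bounded[of u \<tau> w] L]
        by (simp add: dist_norm)
    qed (use r[of t] in \<open>auto intro!: continuous_intros Gu\<close>)
    also have "\<dots> \<le> (L * dist u w) * \<delta>"
      using r[of t] L by (intro mult_left_mono) auto
    also have "\<dots> \<le> 1/2 * dist u w"
      using mult_right_mono[OF \<delta>L, of "dist u w"] by (simp add: mult_ac)
    finally show "dist (apply_bcontfun (Bcontfun (P u)) t) (apply_bcontfun (Bcontfun (P w)) t)
        \<le> 1/2 * dist u w"
      by (simp add: apply_P)
  qed
  then have "\<exists>!u. Bcontfun (P u) = u"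
    by (intro banach_fix_type[of "1/2"]) auto
  then obtain u where "Bcontfun (P u) = u" by blast
  then have u_eq: "apply_bcontfun u t = P u t" for t
    using apply_P[of u] by simp
  have u: "apply_bcontfun u t = x + integral {0..t} (\<lambda>\<tau>. G (apply_bcontfun u \<tau>))"
    if "t \<in> {0..\<delta>}" for t
  proof -
    have "r t = t" using that by (simp add: r_def)
    then show ?thesis by (subst u_eq) (simp add: P_def)
  qed
  show ?thesis
  proof (rule that[OF \<delta>])
    show "apply_bcontfun u 0 = x" by (subst u) (use \<delta> in auto)
    fix t assume t: "t \<in> {0..\<delta>}"
    have "((\<lambda>t. x + integral {0..t} (\<lambda>\<tau>. G (apply_bcontfun u \<tau>))) has_vector_derivative
        (0 + G (apply_bcontfun u t))) (at t within {0..\<delta>})"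
      by (intro has_vector_derivative_add has_vector_derivative_const
          integral_has_vector_derivative Gu t)
    then have "((\<lambda>t. x + integral {0..t} (\<lambda>\<tau>. G (apply_bcontfun u \<tau>))) has_vector_derivative
        G (apply_bcontfun u t)) (at t within {0..\<delta>})"
      by simp
    from has_vector_derivative_transform[OF t u this]
    show "(apply_bcontfun u has_vector_derivative G (apply_bcontfun u t)) (at t within {0..\<delta>})" .
  qed
qed

text \<open>Precomposing \<open>F\<close> with the nearest-point projection onto the ball gives a
  globally Lipschitz field, since the projection is nonexpansive. Its solution starts at the centre
  and by continuity stays in the ball for a short time, during which the projection does
  nothing.\<close>

lemma local_ode_solution_exists:
  fixes F :: "'a::euclidean_space \<Rightarrow> 'a"
  assumes F: "L-lipschitz_on (cball x r) F" and "r > 0"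
  obtains \<delta> u where "\<delta> > 0" "u 0 = x"
    and "\<And>t. t \<in> {0..\<delta>} \<Longrightarrow> (u has_vector_derivative F (u t)) (at t within {0..\<delta>})"
proof -
  let ?p = "closest_point (cball x r)"
  have p: "?p y \<in> cball x r" for y using \<open>r > 0\<close> by (intro closest_point_in_set) auto
  have "L-lipschitz_on UNIV (\<lambda>y. F (?p y))"
  proof (rule lipschitz_onI)
    fix y z
    have "dist (F (?p y)) (F (?p z)) \<le> L * dist (?p y) (?p z)"
      by (rule lipschitz_onD[OF F p p])
    also have "\<dots> \<le> L * dist y z"
      using \<open>r > 0\<close> by (intro mult_left_mono closest_point_lipschitz lipschitz_on_nonneg[OF F]) auto
    finally show "dist (F (?p y)) (F (?p z)) \<le> L * dist y z" .
  qed (rule lipschitz_on_nonneg[OF F])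
  then obtain \<epsilon> u where \<epsilon>: "\<epsilon> > 0" and u0: "u 0 = x"
    and u': "\<And>t. t \<in> {0..\<epsilon>} \<Longrightarrow> (u has_vector_derivative F (?p (u t))) (at t within {0..\<epsilon>})"
    by (rule lipschitz_ode_solution_exists[where x = x]) blast
  have "continuous_on {0..\<epsilon>} u"
    using u' by (rule continuous_on_vector_derivative)
  then obtain d where d: "d > 0" "\<And>t. t \<in> {0..\<epsilon>} \<Longrightarrow> dist t 0 < d \<Longrightarrow> dist (u t) (u 0) < r"
    unfolding continuous_on_iff using \<epsilon> \<open>r > 0\<close> by (metis atLeastAtMost_iff less_imp_le order_refl)
  \<comment> \<open>Halving \<open>d\<close> turns the strict bound on the distance to time 0 into
    one valid on a closed interval.\<close>
  show ?thesis
  proof (rule that[of "min \<epsilon> (d/2)" u])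
    fix t assume t: "t \<in> {0..min \<epsilon> (d/2)}"
    then have "u t \<in> cball x r"
      using d(2)[of t] \<open>d > 0\<close> u0 by (auto simp: dist_commute)
    then have "(u has_vector_derivative F (u t)) (at t within {0..\<epsilon>})"
      using u'[of t] t by (simp add: closest_point_self)
    then show "(u has_vector_derivative F (u t)) (at t within {0..min \<epsilon> (d/2)})"
      by (rule has_vector_derivative_within_subset) auto
  qed (use \<epsilon> \<open>d > 0\<close> u0 in auto)
qed

text \<open>The continuous derivative is bounded on the compact ball, and on a convex set a
  derivative bound is a Lipschitz constant.\<close>

lemma continuously_differentiable_lipschitz_on_cball:
  fixes f :: "'a::euclidean_space \<Rightarrow> 'b::real_normed_vector"
  assumes "continuously_differentiable f"
  obtains L where "L-lipschitz_on (cball x r) f"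
proof -
  obtain f' where f': "\<And>y. (f has_derivative blinfun_apply (f' y)) (at y)"
    and cont: "continuous_on UNIV f'"
    using assms by (auto simp: continuously_differentiable_def)
  have "bounded (f' ` cball x r)"
    using cont by (intro compact_imp_bounded compact_continuous_image) (auto intro: continuous_on_subset)
  then obtain B where B: "0 < B" "\<And>y. y \<in> cball x r \<Longrightarrow> norm (f' y) \<le> B"
    by (auto simp: bounded_pos)
  have "B-lipschitz_on (cball x r) f"
  proof (rule bounded_derivative_imp_lipschitz)
    show "(f has_derivative blinfun_apply (f' y)) (at y within cball x r)" for y
      using f' by (rule has_derivative_at_withinI)
    show "onorm (blinfun_apply (f' y)) \<le> B" if "y \<in> cball x r" for y
      using B(2)[OF that] by (simp add: norm_blinfun.rep_eq)
  qed (use B in auto)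
  then show ?thesis by (rule that)
qed

section \<open>Infinitesimal consequences of energy conservation\<close>

text \<open>A solution running forward from \<open>(v, w)\<close> is enough:
  \<open>conserves_energy\<close> admits intervals that have 0 as an endpoint, and there the
  one-sided derivative of the energy can be computed in two ways.\<close>

lemma energy_conservation_pointwise:
  fixes f :: "(real^'N) \<times> (real^'m) \<Rightarrow> real^'N" and g :: "(real^'N) \<times> (real^'m) \<Rightarrow> real^'m"
  assumes f: "continuously_differentiable f" and g: "continuously_differentiable g"
    and cons: "conserves_energy f g"
  shows "v \<bullet> f (v, w) + w \<bullet> g (v, w) = 0"
proof -
  obtain L M where "L-lipschitz_on (cball (v, w) 1) f" "M-lipschitz_on (cball (v, w) 1) g"
    using continuously_differentiable_lipschitz_on_cball f g by metis
  then have "(sqrt (L\<^sup>2 + M\<^sup>2))-lipschitz_on (cball (v, w) 1) (\<lambda>y. (f y, g y))"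
    by (rule lipschitz_on_Pair)
  then obtain \<delta> u where \<delta>: "\<delta> > 0" and u0: "u 0 = (v, w)"
    and u: "\<And>t. t \<in> {0..\<delta>} \<Longrightarrow> (u has_vector_derivative (f (u t), g (u t))) (at t within {0..\<delta>})"
    by (rule local_ode_solution_exists) auto
  have u1: "((\<lambda>t. fst (u t)) has_vector_derivative f (u t)) (at t within {0..\<delta>})"
    and u2: "((\<lambda>t. snd (u t)) has_vector_derivative g (u t)) (at t within {0..\<delta>})"
    if "t \<in> {0..\<delta>}" for t
    using bounded_linear.has_vector_derivative[OF bounded_linear_fst u[OF that]]
      bounded_linear.has_vector_derivative[OF bounded_linear_snd u[OF that]] by simp_all
  have "solves_system f g {0..\<delta>} (\<lambda>t. fst (u t)) (\<lambda>t. snd (u t))"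
    using u1 u2 by (simp add: solves_system_def)
  then have const: "energy (fst (u t)) (snd (u t)) = energy v w" if "t \<in> {0..\<delta>}" for t
    using cons that \<delta> u0 unfolding conserves_energy_def
    by (metis atLeastAtMost_iff fst_conv is_interval_cc less_imp_le order_refl snd_conv)
  define E where "E = (\<lambda>t. 1/2 * (fst (u t) \<bullet> fst (u t) + snd (u t) \<bullet> snd (u t)))"
  \<comment> \<open>The space \<open>'c\<close> is left general because the rule serves both
    components, which live in different spaces.\<close>
  have inner: "((\<lambda>t. p t \<bullet> p t) has_vector_derivative (2 * (p 0 \<bullet> p'))) (at 0 within {0..\<delta>})"
    if "(p has_vector_derivative p') (at 0 within {0..\<delta>})" for p :: "real \<Rightarrow> 'c::real_inner" and p'
    using bounded_bilinear.has_vector_derivative[OF bounded_bilinear_inner that that]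
    by (simp add: inner_commute)
  have "(E has_vector_derivative (1/2 * (2 * (fst (u 0) \<bullet> f (u 0)) + 2 * (snd (u 0) \<bullet> g (u 0)))))
      (at 0 within {0..\<delta>})"
    unfolding E_def using \<delta>
    by (intro has_vector_derivative_mult_right has_vector_derivative_add inner u1 u2) auto
  moreover have "(E has_vector_derivative 0) (at 0 within {0..\<delta>})"
    by (rule has_vector_derivative_transform[OF _ _ has_vector_derivative_const[of "energy v w"]])
      (use const \<delta> in \<open>auto simp: E_def energy_def power2_norm_eq_inner\<close>)
  \<comment> \<open>The derivative from the product rule and the derivative 0 of a constant agree,
    since one-sided derivatives at an endpoint of a nondegenerate interval are unique.\<close>
  ultimately have "1/2 * (2 * (fst (u 0) \<bullet> f (u 0)) + 2 * (snd (u 0) \<bullet> g (u 0))) = 0"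
    using vector_derivative_unique_within_closed_interval[of 0 \<delta> 0] \<delta> by (simp only: cbox_interval) fastforce
  then show ?thesis by (simp add: u0)
qed

text \<open>Differentiate the identity \<open>zero\<close> in \<open>w\<close> at 0. By the product
  rule the unknown derivative of \<open>g\<close> appears only paired with the factor
  \<open>w = 0\<close>, so it drops out.\<close>

lemma inner_D_w_at_zero:
  fixes f :: "(real^'N) \<times> (real^'m) \<Rightarrow> real^'N" and g :: "(real^'N) \<times> (real^'m) \<Rightarrow> real^'m"
  assumes "continuously_differentiable f" and "continuously_differentiable g"
    and zero: "\<And>w. v \<bullet> f (v, w) + w \<bullet> g (v, w) = 0"
  shows "v \<bullet> (D_w f v 0 *v y) = - (y \<bullet> g (v, 0))"
proof -
  have slice: "(\<lambda>w. F (v, w)) differentiable (at 0)" if F: "continuously_differentiable F"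
    for F :: "(real^'N) \<times> (real^'m) \<Rightarrow> real^'k"
  proof -
    obtain F' where "\<And>x. (F has_derivative blinfun_apply (F' x)) (at x)"
      using F by (auto simp: continuously_differentiable_def)
    from has_derivative_compose[OF has_derivative_Pair[OF has_derivative_const has_derivative_ident] this]
    show ?thesis by (auto simp: differentiable_def)
  qed
  have f': "((\<lambda>w. f (v, w)) has_derivative (\<lambda>y. D_w f v 0 *v y)) (at 0)"
    using slice[OF assms(1)] by (simp add: D_w_eq_jacobian jacobian_works[symmetric])
  obtain G where G: "((\<lambda>w. g (v, w)) has_derivative G) (at 0)"
    using slice[OF assms(2)] by (auto simp: differentiable_def)
  have "((\<lambda>w. v \<bullet> f (v, w) + w \<bullet> g (v, w)) has_derivative
      (\<lambda>y. v \<bullet> (D_w f v 0 *v y) + (0 \<bullet> G y + y \<bullet> g (v, 0)))) (at 0)"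
    by (intro has_derivative_add has_derivative_inner_right has_derivative_inner f' G has_derivative_ident)
  then have "((\<lambda>w. 0) has_derivative
      (\<lambda>y. v \<bullet> (D_w f v 0 *v y) + (0 \<bullet> G y + y \<bullet> g (v, 0)))) (at (0::real^'m))"
    by (simp only: zero)
  from has_derivative_unique[OF this has_derivative_const]
  have "v \<bullet> (D_w f v 0 *v y) + (0 \<bullet> G y + y \<bullet> g (v, 0)) = 0" by metis
  then show ?thesis by simp
qed

text \<open>The choice \<open>y = g (v, 0)\<close> in the preceding identity shows that the memory
  term of the t-model is purely dissipative for \<open>t\<close> positive, while
  \<open>f (v, 0)\<close> contributes nothing.\<close>

lemma inner_t_model:
  fixes f :: "(real^'N) \<times> (real^'m) \<Rightarrow> real^'N" and g :: "(real^'N) \<times> (real^'m) \<Rightarrow> real^'m"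
  assumes "continuously_differentiable f" and "continuously_differentiable g"
    and "conserves_energy f g"
  shows "v \<bullet> t_model f g v t = - t * (norm (g (v, 0)))\<^sup>2"
proof -
  note zero = energy_conservation_pointwise[OF assms]
  have "v \<bullet> f (v, 0) = 0" using zero[of v 0] by simp
  then show ?thesis
    by (simp add: t_model_def inner_add_right inner_D_w_at_zero[OF assms(1,2) zero] power2_norm_eq_inner)
qed

section \<open>Runge-Kutta algebra and averaging\<close>

text \<open>With K the sum of the \<open>b i *\<^sub>R k i\<close>, the left side is 2h (x, K) + h^2
  (K, K). The condition on the coefficients splits (K, K) into two equal double sums
  \<open>?S\<close>, and \<open>h * ?S\<close> is exactly what the stage corrections add to (x, K)
  on the right.\<close>

lemma symplectic_runge_kutta_norm:
  fixes x :: "'a::real_inner" and k :: "'i \<Rightarrow> 'a"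
  assumes symp: "\<And>i j. i \<in> I \<Longrightarrow> j \<in> I \<Longrightarrow> b i * a i j + b j * a j i - b i * b j = 0"
  shows "(norm (x + h *\<^sub>R (\<Sum>i\<in>I. b i *\<^sub>R k i)))\<^sup>2 - (norm x)\<^sup>2
    = 2 * h * (\<Sum>i\<in>I. b i * ((x + h *\<^sub>R (\<Sum>j\<in>I. a i j *\<^sub>R k j)) \<bullet> k i))"
proof -
  let ?S = "\<Sum>i\<in>I. \<Sum>j\<in>I. (b i * a i j) * (k j \<bullet> k i)"
  have "(\<Sum>i\<in>I. b i *\<^sub>R k i) \<bullet> (\<Sum>i\<in>I. b i *\<^sub>R k i)
      = (\<Sum>i\<in>I. \<Sum>j\<in>I. (b i * b j) * (k i \<bullet> k j))"
    by (simp add: inner_sum_left inner_sum_right sum_distrib_left inner_commute mult_ac)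
  also have "\<dots> = (\<Sum>i\<in>I. \<Sum>j\<in>I. (b i * a i j) * (k j \<bullet> k i) + (b j * a j i) * (k i \<bullet> k j))"
  proof (intro sum.cong refl)
    fix i j assume "i \<in> I" "j \<in> I"
    then have "b i * b j = b i * a i j + b j * a j i" using symp by fastforce
    then show "(b i * b j) * (k i \<bullet> k j) = (b i * a i j) * (k j \<bullet> k i) + (b j * a j i) * (k i \<bullet> k j)"
      by (simp add: inner_commute distrib_right)
  qed
  also have "\<dots> = ?S + (\<Sum>i\<in>I. \<Sum>j\<in>I. (b j * a j i) * (k i \<bullet> k j))"
    by (simp add: sum.distrib)
  \<comment> \<open>Exchanging the order of summation renames \<open>i\<close> and \<open>j\<close>,
    which turns this sum into \<open>?S\<close>.\<close>
  also have "(\<Sum>i\<in>I. \<Sum>j\<in>I. (b j * a j i) * (k i \<bullet> k j)) = ?S"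
    by (rule sum.swap)
  finally have sq: "(\<Sum>i\<in>I. b i *\<^sub>R k i) \<bullet> (\<Sum>i\<in>I. b i *\<^sub>R k i) = 2 * ?S" by simp
  have "(\<Sum>i\<in>I. b i * ((x + h *\<^sub>R (\<Sum>j\<in>I. a i j *\<^sub>R k j)) \<bullet> k i))
      = x \<bullet> (\<Sum>i\<in>I. b i *\<^sub>R k i) + h * ?S"
    by (simp add: inner_add_left inner_sum_left inner_sum_right distrib_left sum.distrib
        sum_distrib_left mult_ac)
  then show ?thesis
    by (simp add: power2_norm_eq_inner inner_add_left inner_add_right sq inner_commute algebra_simps)
qed

text \<open>The intermediate value theorem in the form that the continuous real image of a connected
  set is an interval. That interval is convex and contains every \<open>\<phi> (V i)\<close>, hence
  also their weighted average.\<close>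

lemma weighted_average_attained_on_convex_hull:
  fixes \<phi> :: "'a::real_normed_vector \<Rightarrow> real"
  assumes "continuous_on (convex hull (V ` I)) \<phi>" and "finite I"
    and "(\<Sum>i\<in>I. p i) = 1" and "\<And>i. i \<in> I \<Longrightarrow> p i \<ge> 0"
  obtains y where "y \<in> convex hull (V ` I)" "(\<Sum>i\<in>I. p i * \<phi> (V i)) = \<phi> y"
proof -
  have "connected (\<phi> ` (convex hull (V ` I)))"
    using assms(1) by (intro connected_continuous_image convex_connected convex_convex_hull)
  then have "convex (\<phi> ` (convex hull (V ` I)))"
    by (simp add: is_interval_connected_1 is_interval_convex_1[symmetric])
  then have "(\<Sum>i\<in>I. p i *\<^sub>R \<phi> (V i)) \<in> \<phi> ` (convex hull (V ` I))"
    using assms by (intro convex_sum) (auto intro: hull_inc)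
  then show ?thesis using that by auto
qed

section \<open>The energy balance of one step\<close>

theorem mainTheorem1:
  fixes f :: "(real^'N) \<times> (real^'m) \<Rightarrow> real^'N"
    and g :: "(real^'N) \<times> (real^'m) \<Rightarrow> real^'m"
    and a :: "nat \<Rightarrow> nat \<Rightarrow> real" and b c :: "nat \<Rightarrow> real"
    and s n :: nat and h t\<^sub>n :: real
    and v\<^sub>n v\<^sub>n\<^sub>1 :: "real^'N" and k V :: "nat \<Rightarrow> real^'N"
  assumes "continuously_differentiable f" and "continuously_differentiable g"
    and "conserves_energy f g"
    and "s \<ge> 1"
    and "\<And>i. i \<in> {1..s} \<Longrightarrow> b i \<ge> 0" and "\<And>i. i \<in> {1..s} \<Longrightarrow> c i \<ge> 0"
    and "\<And>i j. i \<in> {1..s} \<Longrightarrow> j \<in> {1..s} \<Longrightarrow> b i * a i j + b j * a j i - b i * b j = 0"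
    and "(\<Sum>i=1..s. b i) = 1" and "(\<Sum>i=1..s. b i * c i) = 1/2"
    and "h > 0" and "t\<^sub>n = real n * h"
    and "\<And>i. i \<in> {1..s} \<Longrightarrow>
           k i = t_model f g (v\<^sub>n + h *\<^sub>R (\<Sum>j=1..s. a i j *\<^sub>R k j)) (t\<^sub>n + h * c i)"
    and "v\<^sub>n\<^sub>1 = v\<^sub>n + h *\<^sub>R (\<Sum>i=1..s. b i *\<^sub>R k i)"
    and "\<And>i. i \<in> {1..s} \<Longrightarrow> V i = v\<^sub>n + h *\<^sub>R (\<Sum>j=1..s. a i j *\<^sub>R k j)"
  shows "\<exists>V' \<in> convex hull (V ` {1..s}).
           1/2 * (norm v\<^sub>n\<^sub>1)\<^sup>2 - 1/2 * (norm v\<^sub>n)\<^sup>2 = - h * (t\<^sub>n + h/2) * (norm (g (V', 0)))\<^sup>2"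
proof -
  let ?I = "{1..s}" and ?\<phi> = "\<lambda>y. (norm (g (y, 0)))\<^sup>2" and ?T = "t\<^sub>n + h/2"
  \<comment> \<open>These are the weights of the average. The order conditions on \<open>b\<close>
    and \<open>c\<close> give the numerators the sum \<open>?T\<close>, so the weights sum to 1;
    they are nonnegative because \<open>t\<^sub>n\<close>, \<open>h\<close>, \<open>b i\<close> and
    \<open>c i\<close> are.\<close>
  define p where "p i = b i * (t\<^sub>n + h * c i) / ?T" for i
  have T: "?T > 0" and t: "t\<^sub>n \<ge> 0" using assms(10,11) by (auto intro: add_nonneg_pos)
  have "(\<Sum>i\<in>?I. b i * (t\<^sub>n + h * c i)) = t\<^sub>n * (\<Sum>i\<in>?I. b i) + h * (\<Sum>i\<in>?I. b i * c i)"
    by (simp add: distrib_left sum.distrib sum_distrib_left mult_ac)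
  then have p_sum: "(\<Sum>i\<in>?I. p i) = 1"
    using T assms(8,9) by (simp add: p_def sum_divide_distrib[symmetric])
  have p_nonneg: "p i \<ge> 0" if "i \<in> ?I" for i
    using T t assms(5,6)[OF that] assms(10) by (simp add: p_def)
  obtain g' where "\<And>x. (g has_derivative blinfun_apply (g' x)) (at x)"
    using assms(2) by (auto simp: continuously_differentiable_def)
  then have "continuous_on UNIV g"
    by (meson continuous_at_imp_continuous_on has_derivative_continuous)
  then have "continuous_on (convex hull (V ` ?I)) (\<lambda>y. g (y, 0))"
    by (rule continuous_on_compose2) (auto intro!: continuous_intros)
  then have "continuous_on (convex hull (V ` ?I)) ?\<phi>"
    by (intro continuous_intros)
  then obtain V' where V': "V' \<in> convex hull (V ` ?I)" "(\<Sum>i\<in>?I. p i * ?\<phi> (V i)) = ?\<phi> V'"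
    using weighted_average_attained_on_convex_hull[OF _ _ p_sum p_nonneg] by blast
  have "(norm v\<^sub>n\<^sub>1)\<^sup>2 - (norm v\<^sub>n)\<^sup>2
      = 2 * h * (\<Sum>i\<in>?I. b i * ((v\<^sub>n + h *\<^sub>R (\<Sum>j\<in>?I. a i j *\<^sub>R k j)) \<bullet> k i))"
    unfolding assms(13) using assms(7) by (rule symplectic_runge_kutta_norm)
  also have "(\<Sum>i\<in>?I. b i * ((v\<^sub>n + h *\<^sub>R (\<Sum>j\<in>?I. a i j *\<^sub>R k j)) \<bullet> k i))
      = (\<Sum>i\<in>?I. - ?T * (p i * ?\<phi> (V i)))"
  proof (rule sum.cong[OF refl])
    fix i assume i: "i \<in> ?I"
    \<comment> \<open>The left factor is the stage value \<open>V i\<close>, and \<open>k i\<close>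
      is the t-model at \<open>V i\<close> and the stage time, so the dissipation identity applies
      with that time as its factor.\<close>
    have "(v\<^sub>n + h *\<^sub>R (\<Sum>j\<in>?I. a i j *\<^sub>R k j)) \<bullet> k i = - (t\<^sub>n + h * c i) * ?\<phi> (V i)"
      using inner_t_model[OF assms(1-3), of "V i" "t\<^sub>n + h * c i"] assms(12,14)[OF i] by simp
    moreover have "b i * (t\<^sub>n + h * c i) = ?T * p i" using T by (simp add: p_def)
    ultimately show "b i * ((v\<^sub>n + h *\<^sub>R (\<Sum>j\<in>?I. a i j *\<^sub>R k j)) \<bullet> k i) = - ?T * (p i * ?\<phi> (V i))"
      by (metis mult.assoc mult_minus_left mult_minus_right)
  qed
  also have "\<dots> = - ?T * ?\<phi> V'"
    unfolding V'(2)[symmetric] by (rule sum_distrib_left[symmetric])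
  finally have "(norm v\<^sub>n\<^sub>1)\<^sup>2 - (norm v\<^sub>n)\<^sup>2 = 2 * h * (- ?T * ?\<phi> V')" .
  then have "1/2 * (norm v\<^sub>n\<^sub>1)\<^sup>2 - 1/2 * (norm v\<^sub>n)\<^sup>2 = - h * ?T * ?\<phi> V'"
    by (simp add: algebra_simps)
  with V'(1) show ?thesis by blast
qed

end
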